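(* Let $M$ and $N$ be $F$-module spaces over $\mathbb{T}$, and let $T : M \rightarrow N$ be a $\mathbb{T}$-linear map defined on all of $M$ which is closed, i.e. its graph $\{[x, Tx] : x \in M\}$ is closed in $M \times N$ (equivalently: whenever $x_n \to x$ in $M$ and $Tx_n \to y$ in $N$, one has $Tx = y$). Then $T$ is continuous.
   Context: The ring of bicomplex numbers is $\mathbb{T} = \{z_1 + \iota_2 z_2 : z_1, z_2 \in \mathbb{C}(\iota_1)\}$, where $\mathbb{C}(\iota_1) = \{a + b\iota_1 : a,b\in\mathbb{R}\}$, and $\iota_1,\iota_2$ are independent commuting imaginary units with $\iota_1^2 = \iota_2^2 = -1$. $\mathbb{T}$ is a commutative ring with unit, and it carries the norm $|z_1 + \iota_2 z_2| = \sqrt{|z_1|^2 + |z_2|^2}$ and the induced topology. A topological $\mathbb{T}$-module is a (unital) $\mathbb{T}$-module $M$ with a topology such that addition $M\times M\to M$ and scalar multiplication $\mathbb{T}\times M\to M$ are continuous. An $F$-module space over $\mathbb{T}$ is a topological $\mathbb{T}$-module $M$ whose topology is induced by a metric $\rho$ that is translation invariant ($\rho(x,y)=\rho(x-y,0)$) and complete; one writes $|x| = \rho(x,0)$. A map $T$ between $\mathbb{T}$-modules is $\mathbb{T}$-linear if $T(x+y)=T(x)+T(y)$ and $T(\alpha x)=\alpha T(x)$ for all $x,y$ and all $\alpha\in\mathbb{T}$. The product $M \times N$ of two $F$-module spaces is given the metric $d([x,y],[x',y']) = |x-x'| + |y-y'|$. *)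

theory Defs
  imports "HOL-Analysis.Analysis"
begin

section \<open>Bicomplex numbers\<close>

text \<open>\<open>Bicomplex z1 z2\<close> stands for \<open>z1 + i2 z2\<close>; the coefficient field generated by
  the first imaginary unit is the library type \<open>complex\<close>.\<close>

datatype bicomplex = Bicomplex (bc1: complex) (bc2: complex)

lemma bicomplex_eq_iff: "z = w \<longleftrightarrow> bc1 z = bc1 w \<and> bc2 z = bc2 w"
  by (cases z; cases w) simp

instantiation bicomplex :: comm_ring_1
begin

definition "0 = Bicomplex 0 0"
definition "1 = Bicomplex 1 0"
definition "z + w = Bicomplex (bc1 z + bc1 w) (bc2 z + bc2 w)"
definition "- z = Bicomplex (- bc1 z) (- bc2 z)"
definition "z - w = Bicomplex (bc1 z - bc1 w) (bc2 z - bc2 w)"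
definition "z * w = Bicomplex (bc1 z * bc1 w - bc2 z * bc2 w) (bc1 z * bc2 w + bc2 z * bc1 w)"

instance
  by standard
    (simp_all add: zero_bicomplex_def one_bicomplex_def plus_bicomplex_def uminus_bicomplex_def
      minus_bicomplex_def times_bicomplex_def bicomplex_eq_iff algebra_simps)

end

definition bc_i1 :: bicomplex where "bc_i1 = Bicomplex \<i> 0"
definition bc_i2 :: bicomplex where "bc_i2 = Bicomplex 0 1"

lemma bc_i1_squared: "bc_i1 * bc_i1 = - 1"
  and bc_i2_squared: "bc_i2 * bc_i2 = - 1"
  and Bicomplex_decompose: "Bicomplex z1 z2 = Bicomplex z1 0 + bc_i2 * Bicomplex z2 0"
  by (simp_all add: bc_i1_def bc_i2_def one_bicomplex_def plus_bicomplex_def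
      uminus_bicomplex_def times_bicomplex_def)

instantiation bicomplex :: real_normed_vector
begin

definition "scaleR r z = Bicomplex (r *\<^sub>R bc1 z) (r *\<^sub>R bc2 z)"
definition "norm z = sqrt ((cmod (bc1 z))\<^sup>2 + (cmod (bc2 z))\<^sup>2)"
definition "sgn z = inverse (norm z) *\<^sub>R (z :: bicomplex)"
definition "dist z w = norm (z - w :: bicomplex)"
definition "uniformity = (INF e\<in>{0<..}. principal {(x, y :: bicomplex). dist x y < e})"
definition "open (U :: bicomplex set) \<longleftrightarrow>
  (\<forall>x\<in>U. eventually (\<lambda>(x', y). x' = x \<longrightarrow> y \<in> U) uniformity)"

instance
proof
  have norm_pair: "norm z = norm (bc1 z, bc2 z)" for z :: bicomplex
    by (simp add: norm_bicomplex_def norm_Pair)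
  fix r s :: real and x y :: bicomplex
  show "r *\<^sub>R (x + y) = r *\<^sub>R x + r *\<^sub>R y" "(r + s) *\<^sub>R x = r *\<^sub>R x + s *\<^sub>R x"
    "r *\<^sub>R s *\<^sub>R x = (r * s) *\<^sub>R x" "1 *\<^sub>R x = x"
    by (simp_all add: scaleR_bicomplex_def plus_bicomplex_def bicomplex_eq_iff algebra_simps)
  show "sgn x = inverse (norm x) *\<^sub>R x" by (rule sgn_bicomplex_def)
  show "norm x = 0 \<longleftrightarrow> x = 0"
    by (simp add: norm_pair zero_bicomplex_def bicomplex_eq_iff zero_prod_def)
  show "norm (x + y) \<le> norm x + norm y"
    using norm_triangle_ineq[of "(bc1 x, bc2 x)" "(bc1 y, bc2 y)"]
    by (simp add: norm_pair plus_bicomplex_def)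
  show "norm (r *\<^sub>R x) = \<bar>r\<bar> * norm x"
    using norm_scaleR[of r "(bc1 x, bc2 x)"] by (simp add: norm_pair scaleR_bicomplex_def)
qed (fact dist_bicomplex_def uniformity_bicomplex_def open_bicomplex_def)+

end

section \<open>F-module spaces\<close>

locale topological_bicomplex_module = module scale
  for scale :: "bicomplex \<Rightarrow> 'm::{ab_group_add, topological_space} \<Rightarrow> 'm" +
  assumes continuous_add: "continuous_on UNIV (\<lambda>(x, y). x + y :: 'm)"
    and continuous_scale: "continuous_on UNIV (\<lambda>(a, x). scale a x)"

text \<open>The class \<open>complete_space\<close> supplies the metric \<open>dist\<close>, its completeness, and the
  fact that the topology is the one induced by it; no compatibility between \<open>dist\<close> and the group
  structure is implied by the type class constraints.\<close>

locale F_module_space = topological_bicomplex_module scale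
  for scale :: "bicomplex \<Rightarrow> 'm::{ab_group_add, complete_space} \<Rightarrow> 'm" +
  assumes dist_translation_invariant: "dist x y = dist (x - y) (0 :: 'm)"

definition F_abs :: "'m::{ab_group_add, metric_space} \<Rightarrow> real" where
  "F_abs x = dist x 0"

text \<open>The sum metric on a product; the library's \<open>dist\<close> on pairs is the Euclidean combination
  instead.\<close>

definition F_prod_dist ::
    "'m::{ab_group_add, metric_space} \<times> 'n::{ab_group_add, metric_space} \<Rightarrow> 'm \<times> 'n \<Rightarrow> real" where
  "F_prod_dist p q = F_abs (fst p - fst q) + F_abs (snd p - snd q)"

text \<open>Meaningful for F-module spaces, where \<open>F_prod_dist\<close> is a metric.\<close>

definition F_prod_topology ::
    "('m::{ab_group_add, metric_space} \<times> 'n::{ab_group_add, metric_space}) topology" where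
  "F_prod_topology = Metric_space.mtopology UNIV F_prod_dist"

lemma Metric_space_F_prod_dist:
  fixes sM :: "bicomplex \<Rightarrow> 'm::{ab_group_add, complete_space} \<Rightarrow> 'm"
    and sN :: "bicomplex \<Rightarrow> 'n::{ab_group_add, complete_space} \<Rightarrow> 'n"
  assumes "F_module_space sM" "F_module_space sN"
  shows "Metric_space UNIV (F_prod_dist :: 'm \<times> 'n \<Rightarrow> 'm \<times> 'n \<Rightarrow> real)"
proof -
  have eq: "F_prod_dist p q = dist (fst p) (fst q) + dist (snd p) (snd q)" for p q :: "'m \<times> 'n"
    unfolding F_prod_dist_def F_abs_def
    by (metis F_module_space.dist_translation_invariant assms)
  show ?thesis
  proof
    fix p q r :: "'m \<times> 'n"
    show "0 \<le> F_prod_dist p q" "F_prod_dist p q = F_prod_dist q p"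
      by (simp_all add: eq dist_commute)
    show "F_prod_dist p q = 0 \<longleftrightarrow> p = q"
      by (simp add: eq add_nonneg_eq_0_iff prod_eq_iff)
    show "F_prod_dist p r \<le> F_prod_dist p q + F_prod_dist q r"
      using dist_triangle[of "fst p" "fst r" "fst q"] dist_triangle[of "snd p" "snd r" "snd q"]
      by (simp add: eq)
  qed
qed

definition closed_map_graph ::
    "('m::{ab_group_add, metric_space} \<Rightarrow> 'n::{ab_group_add, metric_space}) \<Rightarrow> bool" where
  "closed_map_graph T \<longleftrightarrow> closedin F_prod_topology {(x, T x) | x. True}"

end

theory Submission
  imports Defs
begin

text \<open>This is Banach's argument, with the scaling by \<open>1/n\<close> taken inside the ring of scalars. Each
  preimage under \<open>T\<close> of a ball around \<open>0\<close> is absorbing, so by Baire's theorem its closure contains a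
  neighbourhood of \<open>0\<close>. Correcting the error at geometrically decreasing scales writes a
  small \<open>x\<close> as a limit of partial sums whose images form a Cauchy sequence close to \<open>0\<close>; closedness of
  the graph identifies the limit of the images with \<open>T x\<close>.\<close>

section \<open>Real scalars and continuity of the module operations\<close>

text \<open>The modules accept only bicomplex scalars, so real factors must pass through the ring;
  the form \<open>r *\<^sub>R 1\<close> yields continuity in \<open>r\<close> at once.\<close>

definition bc_of_real :: "real \<Rightarrow> bicomplex" where
  "bc_of_real r = r *\<^sub>R 1"

lemma bc_of_real_mult: "bc_of_real r * bc_of_real s = bc_of_real (r * s)"
  by (simp add: bc_of_real_def scaleR_bicomplex_def one_bicomplex_def times_bicomplex_def)

lemma bc_of_real_0 [simp]: "bc_of_real 0 = 0"
  and bc_of_real_1 [simp]: "bc_of_real 1 = 1"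
  by (simp_all add: bc_of_real_def)

lemma tendsto_bc_of_real:
  assumes "(f \<longlongrightarrow> r) F"
  shows "((\<lambda>x. bc_of_real (f x)) \<longlongrightarrow> bc_of_real r) F"
  unfolding bc_of_real_def by (intro tendsto_intros assms)

context topological_bicomplex_module
begin

lemma tendsto_scale_left:
  assumes "(f \<longlongrightarrow> a) F"
  shows "((\<lambda>n. scale (f n) x) \<longlongrightarrow> scale a x) F"
proof -
  have "((\<lambda>n. (f n, x)) \<longlongrightarrow> (a, x)) F"
    by (intro tendsto_intros assms)
  from continuous_on_tendsto_compose[OF continuous_scale this] show ?thesis
    by simp
qed

lemma continuous_on_scale_right: "continuous_on S (scale a)"
proof -
  have "continuous_on S (\<lambda>x. (a, x))"
    by (intro continuous_intros)
  from continuous_on_compose2[OF continuous_scale this] show ?thesis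
    by simp
qed

end

context F_module_space
begin

lemma dist_diff_0: "dist (x - y) (0 :: 'm) = dist x y"
  by (rule dist_translation_invariant[symmetric])

lemma dist_diff_right: "dist (x - z) (y - z) = dist x (y :: 'm)"
  using dist_diff_0[of "x - z" "y - z"] dist_diff_0[of x y] by simp

lemma dist_add_right: "dist (x + z) (y + z) = dist x (y :: 'm)"
  using dist_diff_right[of "x + z" z "y + z"] by simp

lemma continuous_on_diff_const: "continuous_on S (\<lambda>x. x - a :: 'm)"
  unfolding continuous_on_iff by (auto simp: dist_diff_right)

end

section \<open>Baire category, closed graphs and almost openness at 0\<close>

text \<open>Otherwise Baire's theorem would give the union empty interior, but the whole space is
  its own nonempty interior.\<close>

lemma Baire_union_UNIV:
  fixes F :: "nat \<Rightarrow> 'a::complete_space set"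
  assumes "\<And>n. closed (F n)" and "(\<Union>n. F n) = UNIV"
  shows "\<exists>n. interior (F n) \<noteq> {}"
proof (rule ccontr)
  assume *: "\<not> ?thesis"
  have "Met_TC.mtopology interior_of \<Union>(range F) = {}"
  proof (rule Met_TC.metric_Baire_category_alt)
    show "Met_TC.mcomplete TYPE('a)"
      by (simp add: complete_UNIV)
    fix S assume "S \<in> range F"
    then show "closedin Met_TC.mtopology S \<and> Met_TC.mtopology interior_of S = {}"
      using assms(1) * by auto
  qed auto
  then show False
    using assms(2) by simp
qed

text \<open>Translation invariance turns \<open>F_prod_dist\<close> into the sum of the two
  distances, so componentwise convergence is convergence of the pairs, and a closed set keeps its
  limits.\<close>

lemma closed_map_graph_sequentially:
  fixes scaleM :: "bicomplex \<Rightarrow> 'm::{ab_group_add, complete_space} \<Rightarrow> 'm"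
    and scaleN :: "bicomplex \<Rightarrow> 'n::{ab_group_add, complete_space} \<Rightarrow> 'n"
    and T :: "'m \<Rightarrow> 'n"
  assumes M: "F_module_space scaleM" and N: "F_module_space scaleN"
    and "closed_map_graph T"
    and x: "s \<longlonglongrightarrow> x" and y: "(\<lambda>n. T (s n)) \<longlonglongrightarrow> y"
  shows "T x = y"
proof -
  interpret P: Metric_space UNIV "F_prod_dist :: 'm \<times> 'n \<Rightarrow> 'm \<times> 'n \<Rightarrow> real"
    using M N by (rule Metric_space_F_prod_dist)
  have eq: "F_prod_dist p q = dist (fst p) (fst q) + dist (snd p) (snd q)" for p q :: "'m \<times> 'n"
    using F_module_space.dist_diff_0[OF M] F_module_space.dist_diff_0[OF N]
    by (simp add: F_prod_dist_def F_abs_def)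
  have "(\<lambda>n. dist (s n) x + dist (T (s n)) y) \<longlonglongrightarrow> 0 + 0"
    using x y by (intro tendsto_add) (simp_all flip: tendsto_dist_iff)
  then have "limitin P.mtopology (\<lambda>n. (s n, T (s n))) (x, y) sequentially"
    by (simp add: P.limitin_metric_dist_null eq)
  moreover have "closedin P.mtopology {(x, T x) | x. True}"
    using assms(3) by (simp add: closed_map_graph_def F_prod_topology_def)
  ultimately have "(x, y) \<in> {(x, T x) | x. True}"
    by (rule limitin_closedin) auto
  then show ?thesis
    by auto
qed

text \<open>Baire yields a closure with an interior point somewhere; subtracting a point of the set
  moves it to 0, and rescaling returns to the preimage of the ball.\<close>

lemma closure_vimage_ball_nhd:
  fixes T :: "'m::{ab_group_add, complete_space} \<Rightarrow> 'n::{ab_group_add, complete_space}"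
  assumes M: "F_module_space scaleM" and N: "F_module_space scaleN"
    and T: "module_hom scaleM scaleN T" and "e > 0"
  shows "\<exists>d>0. ball 0 d \<subseteq> closure (T -` ball 0 e)"
proof -
  interpret M: F_module_space scaleM by fact
  interpret N: F_module_space scaleN by fact
  interpret T: module_hom scaleM scaleN T by fact
  define c where "c k = bc_of_real (inverse (real (Suc k)))" for k
  \<comment> \<open>Half the radius, because \<open>shift\<close> takes the difference of two such
    points.\<close>
  define A where "A k = {x. dist 0 (T (scaleM (c k) x)) < e / 2}" for k
  have "\<exists>k. x \<in> A k" for x
  proof -
    have "(\<lambda>k. scaleN (c k) (T x)) \<longlonglongrightarrow> scaleN (bc_of_real 0) (T x)"
      unfolding c_def
      by (intro N.tendsto_scale_left tendsto_bc_of_real LIMSEQ_inverse_real_of_nat)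
    then have "\<forall>\<^sub>F k in sequentially. dist (scaleN (c k) (T x)) 0 < e / 2"
      using \<open>e > 0\<close> by (intro tendstoD) simp_all
    then show ?thesis
      by (auto simp: A_def T.scale dist_commute eventually_sequentially)
  qed
  then have "(\<Union>k. closure (A k)) = UNIV"
    using closure_subset by blast
  then obtain k where k: "interior (closure (A k)) \<noteq> {}"
    using Baire_union_UNIV[of "\<lambda>k. closure (A k)"] by auto
  \<comment> \<open>The centre \<open>a\<close> has to lie in \<open>A k\<close> itself, so that its
    image is under control.\<close>
  then have "interior (closure (A k)) \<inter> A k \<noteq> {}"
    using open_Int_closure_eq_empty[OF open_interior] interior_subset[of "closure (A k)"] by blast
  then obtain a where a: "a \<in> interior (closure (A k))" "a \<in> A k"
    by blast
  then obtain r where r: "r > 0" "ball a r \<subseteq> closure (A k)"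
    by (meson mem_interior)
  define B where "B = T -` ball 0 e"
  have shift: "scaleM (c k) (x - a) \<in> B" if "x \<in> A k" for x
  proof -
    let ?u = "T (scaleM (c k) x)" and ?v = "T (scaleM (c k) a)"
    have "dist 0 (?u - ?v) \<le> dist 0 ?u + dist 0 ?v"
      using N.dist_diff_0[of ?u ?v] dist_triangle[of ?u ?v 0] by (simp add: dist_commute)
    also have "\<dots> < e"
      using that a(2) by (simp add: A_def)
    finally show ?thesis
      by (simp add: B_def M.scale_right_diff_distrib T.diff)
  qed
  \<comment> \<open>By continuity, \<open>shift\<close> passes to the closures.\<close>
  have "(\<lambda>x. scaleM (c k) (x - a)) ` closure (A k) \<subseteq> closure B"
  proof (rule image_closure_subset)
    show "continuous_on (closure (A k)) (\<lambda>x. scaleM (c k) (x - a))"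
      by (rule continuous_on_compose2[OF M.continuous_on_scale_right M.continuous_on_diff_const subset_UNIV])
    show "(\<lambda>x. scaleM (c k) (x - a)) ` A k \<subseteq> closure B"
      using shift closure_subset by blast
  qed simp
  then have B: "scaleM (c k) h \<in> closure B" if "dist 0 h < r" for h
  proof -
    have "dist a (a + h) < r"
      using that M.dist_add_right[of 0 a h] by (simp add: add.commute)
    then have "a + h \<in> closure (A k)"
      using r(2) by auto
    from subsetD[OF \<open>_ \<subseteq> closure B\<close> imageI[OF this]] show ?thesis
      by simp
  qed
  \<comment> \<open>The metric need not be homogeneous, so the ball cannot simply be rescaled; its
    preimage under multiplication by \<open>Suc k\<close>, the inverse of \<open>c k\<close>, is
    still an open neighbourhood of 0.\<close>
  define U where "U = scaleM (bc_of_real (real (Suc k))) -` ball 0 r"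
  have "open U"
    unfolding U_def by (rule open_vimage[OF open_ball M.continuous_on_scale_right])
  moreover have "0 \<in> U"
    using r(1) by (simp add: U_def)
  ultimately obtain d where d: "d > 0" "ball 0 d \<subseteq> U"
    by (meson open_contains_ball)
  have "x \<in> closure B" if "x \<in> U" for x
  proof -
    have "scaleM (c k) (scaleM (bc_of_real (real (Suc k))) x) \<in> closure B"
      using that by (intro B) (simp add: U_def)
    then show ?thesis
      by (simp add: c_def bc_of_real_mult del: of_nat_Suc)
  qed
  then show ?thesis
    using d unfolding B_def by blast
qed

section \<open>Sequences with geometrically decreasing steps\<close>

text \<open>The subtracted tail makes the induction close: a step of \<open>e / 2 ^ n\<close>
  exactly halves \<open>2 * e / 2 ^ n\<close>.\<close>

lemma dist_geometric_bound:
  fixes u :: "nat \<Rightarrow> 'a::metric_space"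
  assumes "\<And>n. dist (u n) (u (Suc n)) \<le> e / 2 ^ n" and "m \<le> n"
  shows "dist (u m) (u n) \<le> 2 * e / 2 ^ m - 2 * e / 2 ^ n"
  using \<open>m \<le> n\<close>
proof (induction n rule: dec_induct)
  case (step n)
  have "dist (u m) (u (Suc n)) \<le> dist (u m) (u n) + dist (u n) (u (Suc n))"
    by (rule dist_triangle)
  also have "\<dots> \<le> (2 * e / 2 ^ m - 2 * e / 2 ^ n) + e / 2 ^ n"
    using step.IH assms(1) by (intro add_mono)
  also have "\<dots> = 2 * e / 2 ^ m - 2 * e / 2 ^ Suc n"
    by (simp add: field_simps)
  finally show ?case .
qed simp

text \<open>The tails make the sequence Cauchy, and the bound on the distance from
  \<open>u 0\<close> survives in the limit.\<close>

lemma geometric_limit: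
  fixes u :: "nat \<Rightarrow> 'a::complete_space"
  assumes "\<And>n. dist (u n) (u (Suc n)) \<le> e / 2 ^ n" and "e \<ge> 0"
  shows "\<exists>l. u \<longlonglongrightarrow> l \<and> dist (u 0) l \<le> 2 * e"
proof -
  have bound: "dist (u m) (u n) \<le> 2 * e / 2 ^ m" if "m \<le> n" for m n
    using dist_geometric_bound[of u e, OF assms(1) that] \<open>e \<ge> 0\<close>
    by (smt (verit) divide_nonneg_nonneg zero_le_power)
  have "(\<lambda>n. 2 * e * (1 / 2) ^ n) \<longlonglongrightarrow> 2 * e * 0"
    by (intro tendsto_intros LIMSEQ_power_zero) simp
  then have lim: "(\<lambda>n. 2 * e / 2 ^ n) \<longlonglongrightarrow> 0"
    by (simp add: power_one_over)
  have "Cauchy u"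
    unfolding Cauchy_altdef
  proof (intro allI impI)
    fix \<epsilon> :: real assume "\<epsilon> > 0"
    from order_tendstoD(2)[OF lim this] obtain K where "\<And>n. n \<ge> K \<Longrightarrow> 2 * e / 2 ^ n < \<epsilon>"
      by (auto simp: eventually_sequentially)
    then show "\<exists>K. \<forall>m\<ge>K. \<forall>n>m. dist (u m) (u n) < \<epsilon>"
      using bound by (meson le_less_trans less_imp_le)
  qed
  then obtain l where l: "u \<longlonglongrightarrow> l"
    by (auto simp: Cauchy_convergent_iff convergent_def)
  have "dist (u 0) l \<le> 2 * e"
    using bound[of 0] by (intro tendsto_upperbound[OF tendsto_dist[OF tendsto_const l]]) auto
  with l show ?thesis
    by blast
qed

section \<open>Successive approximation and continuity\<close>

theorem theorem3p3:
  fixes scaleM :: "bicomplex \<Rightarrow> 'm::{ab_group_add, complete_space} \<Rightarrow> 'm"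
    and scaleN :: "bicomplex \<Rightarrow> 'n::{ab_group_add, complete_space} \<Rightarrow> 'n"
    and T :: "'m \<Rightarrow> 'n"
  assumes "F_module_space scaleM"
    and "F_module_space scaleN"
    and "module_hom scaleM scaleN T"
    and "closed_map_graph T"
  shows "continuous_on UNIV T"
proof -
  interpret M: F_module_space scaleM by fact
  interpret N: F_module_space scaleN by fact
  interpret T: module_hom scaleM scaleN T by fact
  \<comment> \<open>The factor 2 is the sum of the tolerances \<open>e / 2 ^ k\<close> over all
    stages.\<close>
  have at_0: "\<exists>d>0. \<forall>x. dist 0 x < d \<longrightarrow> dist 0 (T x) \<le> 2 * e" if "e > 0" for e
  proof -
    \<comment> \<open>The cap \<open>1 / 2 ^ k\<close> later forces the approximations to converge
      to \<open>x\<close>.\<close>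
    have "\<exists>d>0. d \<le> 1 / 2 ^ k \<and> ball 0 d \<subseteq> closure (T -` ball 0 (e / 2 ^ k))" for k :: nat
    proof -
      obtain d where "d > 0" "ball 0 d \<subseteq> closure (T -` ball 0 (e / 2 ^ k))"
        using closure_vimage_ball_nhd[OF assms(1-3), of "e / 2 ^ k"] \<open>e > 0\<close> by auto
      then show ?thesis
        by (intro exI[of _ "min d (1 / 2 ^ k)"]) auto
    qed
    then obtain d where d: "\<And>k. d k > 0" "\<And>k. d k \<le> 1 / 2 ^ k"
        "\<And>k. ball 0 (d k) \<subseteq> closure (T -` ball 0 (e / 2 ^ k))"
      by metis
    have "dist 0 (T x) \<le> 2 * e" if x: "dist 0 x < d 0" for x
    proof -
      \<comment> \<open>The residual \<open>x - s\<close> lies in a closure, so some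
        \<open>y\<close> with small image approximates it within the next radius;
        \<open>y + s\<close> is the new approximation.\<close>
      have step: "\<exists>s'. dist x s' < d (Suc k) \<and> dist (T s) (T s') \<le> e / 2 ^ k"
        if "dist x s < d k" for s k
      proof -
        have "x - s \<in> ball 0 (d k)"
          using that by (simp add: dist_commute[of 0] M.dist_diff_0)
        then have "x - s \<in> closure (T -` ball 0 (e / 2 ^ k))"
          using d(3) by blast
        then obtain y where y: "dist 0 (T y) < e / 2 ^ k" "dist y (x - s) < d (Suc k)"
          using d(1)[of "Suc k"] by (auto simp: closure_approachable)
        have "dist x (y + s) < d (Suc k)"
          using y(2) M.dist_add_right[of y s "x - s"] by (simp add: dist_commute)
        moreover have "dist (T s) (T (y + s)) \<le> e / 2 ^ k"
          using y(1) N.dist_add_right[of 0 "T s" "T y"] by (simp add: T.add)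
        ultimately show ?thesis
          by blast
      qed
      obtain s where s: "s 0 = 0" "\<And>k. dist x (s k) < d k"
          "\<And>k. dist (T (s k)) (T (s (Suc k))) \<le> e / 2 ^ k"
      proof -
        \<comment> \<open>The clause for \<open>k = 0\<close> pins the start of the dependent choice
          at 0, where the hypothesis on \<open>x\<close> is the required bound.\<close>
        have "\<exists>s. \<forall>k. (dist x (s k) < d k \<and> (k = 0 \<longrightarrow> s k = 0)) \<and>
            dist (T (s k)) (T (s (Suc k))) \<le> e / 2 ^ k"
          using x step by (intro dependent_nat_choice) (auto simp: dist_commute)
        then show ?thesis
          using that by blast
      qed
      have "s \<longlonglongrightarrow> x"
      proof -
        have "(\<lambda>k. dist (s k) x) \<longlonglongrightarrow> 0"
        proof (rule tendsto_sandwich[OF _ _ tendsto_const])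
          show "\<forall>\<^sub>F k in sequentially. dist (s k) x \<le> (1 / 2) ^ k"
            using order.strict_trans2[OF s(2) d(2)]
            by (intro always_eventually allI less_imp_le) (simp add: dist_commute power_one_over)
          show "(\<lambda>k. (1 / 2 :: real) ^ k) \<longlonglongrightarrow> 0"
            by (rule LIMSEQ_power_zero) simp
        qed auto
        then show ?thesis
          by (simp flip: tendsto_dist_iff)
      qed
      moreover obtain y where "(\<lambda>k. T (s k)) \<longlonglongrightarrow> y" "dist (T (s 0)) y \<le> 2 * e"
        using geometric_limit[of "\<lambda>k. T (s k)" e] s(3) \<open>e > 0\<close> by auto
      \<comment> \<open>The closed graph forces \<open>y = T x\<close>, and
        \<open>T (s 0) = 0\<close>.\<close>
      ultimately show ?thesis
        using closed_map_graph_sequentially[OF assms(1,2,4)] s(1) by auto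
    qed
    with d(1) show ?thesis
      by blast
  qed
  show ?thesis
    unfolding continuous_on_iff
  proof (intro ballI allI impI)
    fix x and e :: real assume "e > 0"
    \<comment> \<open>With \<open>e / 3\<close>, the weak bound at 0 lies strictly below
      \<open>e\<close>; linearity and invariance carry it to every point.\<close>
    then obtain d where d: "d > 0" "\<And>x. dist 0 x < d \<Longrightarrow> dist 0 (T x) \<le> 2 * (e / 3)"
      using at_0[of "e / 3"] by auto
    have "dist (T x') (T x) < e" if "dist x' x < d" for x'
      using d(2)[of "x' - x"] that \<open>e > 0\<close>
      by (simp add: dist_commute[of 0] M.dist_diff_0 N.dist_diff_0 T.diff)
    with d(1) show "\<exists>d>0. \<forall>x'\<in>UNIV. dist x' x < d \<longrightarrow> dist (T x') (T x) < e"
      by auto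
  qed
qed

end
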